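(* Let $X$ be a Tychonoff space and let $I$ be an ideal in $C(X)$. Then the following statements are equivalent: (1) $C_{m^I}(X)$ is $\aleph_0$-bounded. (2) $C_{u^I}(X)$ is $\aleph_0$-bounded. (3) $X$ is compact and metrizable, and $I=C(X)$. (4) $C_{m^I}(X)$ is separable. (5) $C_{m^I}(X)$ satisfies the countable chain condition. (6) $C_{m^I}(X)$ is second countable. (7) $C_{m^I}(X)$ is Lindelöf. (8) $C_{u^I}(X)$ is separable. (9) $C_{u^I}(X)$ is Lindelöf. (10) $C_{u^I}(X)$ satisfies the countable chain condition. (11) $C_{u^I}(X)$ is second countable.
   Context: $C(X)$ is the ring of all real-valued continuous functions on $X$; ideals may be improper. $C_+(X)$ is the set of strictly positive $u\in C(X)$. The $u^I$-topology on $C(X)$ has as base the sets $B_u(f,I,\epsilon)=\{g\in C(X):\sup_{x\in X}|f(x)-g(x)|<\epsilon,\ f-g\in I\}$, $f\in C(X)$, $\epsilon>0$; $C_{u^I}(X)$ is $C(X)$ with this topology. The $m^I$-topology has as base the sets $B_m(f,I,u)=\{g\in C(X):|f(x)-g(x)|<u(x)\ \forall x\in X,\ f-g\in I\}$, $f\in C(X)$, $u\in C_+(X)$; $C_{m^I}(X)$ is $C(X)$ with this topology. Both are topological groups under pointwise addition. A topological group $G$ (written additively) is $\aleph_0$-bounded if for each neighborhood $V$ of the identity there is a countable set $A\subseteq G$ with $G=A+V$. A space satisfies the countable chain condition if every family of pairwise disjoint nonempty open subsets is countable. *)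

theory Defs
  imports "HOL-Analysis.Analysis" "HOL-Algebra.Ideal"
begin

definition Tychonoff_space :: "'a topology \<Rightarrow> bool" where
  "Tychonoff_space X \<longleftrightarrow> completely_regular_space X \<and> Hausdorff_space X"

(* The ring C(X). Its elements are taken extensional on topspace X, so that equality in HOL is
   equality of functions on X. *)
definition C_ring :: "'a topology \<Rightarrow> ('a \<Rightarrow> real) ring" where
  "C_ring X = \<lparr>carrier = {f \<in> extensional (topspace X). continuous_map X euclideanreal f},
     mult = (\<lambda>f g. \<lambda>x\<in>topspace X. f x * g x),
     one = (\<lambda>x\<in>topspace X. 1),
     zero = (\<lambda>x\<in>topspace X. 0),
     add = (\<lambda>f g. \<lambda>x\<in>topspace X. f x + g x)\<rparr>"

definition C_plus :: "'a topology \<Rightarrow> ('a \<Rightarrow> real) set" where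
  "C_plus X = {u \<in> carrier (C_ring X). \<forall>x\<in>topspace X. 0 < u x}"

(* The supremum is taken in the extended reals because f - g may be unbounded. *)
definition B_u :: "'a topology \<Rightarrow> ('a \<Rightarrow> real) \<Rightarrow> ('a \<Rightarrow> real) set \<Rightarrow> real \<Rightarrow> ('a \<Rightarrow> real) set" where
  "B_u X f I \<epsilon> = {g \<in> carrier (C_ring X).
     (SUP x\<in>topspace X. ereal \<bar>f x - g x\<bar>) < ereal \<epsilon> \<and> f \<ominus>\<^bsub>C_ring X\<^esub> g \<in> I}"

definition B_m :: "'a topology \<Rightarrow> ('a \<Rightarrow> real) \<Rightarrow> ('a \<Rightarrow> real) set \<Rightarrow> ('a \<Rightarrow> real) \<Rightarrow> ('a \<Rightarrow> real) set" where
  "B_m X f I u = {g \<in> carrier (C_ring X).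
     (\<forall>x\<in>topspace X. \<bar>f x - g x\<bar> < u x) \<and> f \<ominus>\<^bsub>C_ring X\<^esub> g \<in> I}"

(* For an ideal I the generating families of the next two topologies are bases, not merely
   subbases: see openin_uI_topology and openin_mI_topology below. *)
definition uI_topology :: "'a topology \<Rightarrow> ('a \<Rightarrow> real) set \<Rightarrow> ('a \<Rightarrow> real) topology" where
  "uI_topology X I = topology_generated_by {B_u X f I \<epsilon> |f \<epsilon>. f \<in> carrier (C_ring X) \<and> 0 < \<epsilon>}"

definition mI_topology :: "'a topology \<Rightarrow> ('a \<Rightarrow> real) set \<Rightarrow> ('a \<Rightarrow> real) topology" where
  "mI_topology X I = topology_generated_by {B_m X f I u |f u. f \<in> carrier (C_ring X) \<and> u \<in> C_plus X}"

(* G carries the additive group structure and T the topology. *)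
definition aleph0_bounded :: "('g, 'm) ring_scheme \<Rightarrow> 'g topology \<Rightarrow> bool" where
  "aleph0_bounded G T \<longleftrightarrow>
     (\<forall>V. V \<subseteq> carrier G \<and> (\<exists>U. openin T U \<and> \<zero>\<^bsub>G\<^esub> \<in> U \<and> U \<subseteq> V) \<longrightarrow>
        (\<exists>A. countable A \<and> A \<subseteq> carrier G \<and> carrier G = A <+>\<^bsub>G\<^esub> V))"

definition countable_chain_condition :: "'b topology \<Rightarrow> bool" where
  "countable_chain_condition T \<longleftrightarrow>
     (\<forall>\<U>. (\<forall>U\<in>\<U>. openin T U \<and> U \<noteq> {}) \<and> pairwise disjnt \<U> \<longrightarrow> countable \<U>)"

lemma restrict_in_C_ring:
  "continuous_map X euclideanreal f \<Longrightarrow> restrict f (topspace X) \<in> carrier (C_ring X)"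
  by (auto simp: C_ring_def elim: continuous_map_eq)

lemma continuous_map_C_ring:
  "f \<in> carrier (C_ring X) \<Longrightarrow> continuous_map X euclideanreal f"
  by (simp add: C_ring_def)

lemma C_ring_eqI:
  assumes "f \<in> carrier (C_ring X)" "g \<in> carrier (C_ring X)" "\<And>x. x \<in> topspace X \<Longrightarrow> f x = g x"
  shows "f = g"
  using assms by (auto simp: C_ring_def intro: extensionalityI)

lemma C_ring_sel:
  "mult (C_ring X) f g = (\<lambda>x\<in>topspace X. f x * g x)"
  "one (C_ring X) = (\<lambda>x\<in>topspace X. 1)"
  "zero (C_ring X) = (\<lambda>x\<in>topspace X. 0)"
  "add (C_ring X) f g = (\<lambda>x\<in>topspace X. f x + g x)"
  by (simp_all add: C_ring_def)

lemma C_ring_closed: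
  "(\<lambda>x\<in>topspace X. c) \<in> carrier (C_ring X)"
  "f \<in> carrier (C_ring X) \<Longrightarrow> (\<lambda>x\<in>topspace X. - f x) \<in> carrier (C_ring X)"
  "f \<in> carrier (C_ring X) \<Longrightarrow> g \<in> carrier (C_ring X) \<Longrightarrow> (\<lambda>x\<in>topspace X. f x + g x) \<in> carrier (C_ring X)"
  "f \<in> carrier (C_ring X) \<Longrightarrow> g \<in> carrier (C_ring X) \<Longrightarrow> (\<lambda>x\<in>topspace X. f x - g x) \<in> carrier (C_ring X)"
  "f \<in> carrier (C_ring X) \<Longrightarrow> g \<in> carrier (C_ring X) \<Longrightarrow> (\<lambda>x\<in>topspace X. f x * g x) \<in> carrier (C_ring X)"
  by (intro restrict_in_C_ring continuous_map_const[THEN iffD2]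
      continuous_map_add continuous_map_diff continuous_map_minus continuous_map_real_mult
      continuous_map_C_ring; simp)+

lemma cring_C_ring: "cring (C_ring X)"
proof (rule cringI)
  show "abelian_group (C_ring X)"
  proof (rule abelian_groupI)
    fix f assume f: "f \<in> carrier (C_ring X)"
    show "\<exists>y\<in>carrier (C_ring X). y \<oplus>\<^bsub>C_ring X\<^esub> f = \<zero>\<^bsub>C_ring X\<^esub>"
      by (rule bexI[OF _ C_ring_closed(2)[OF f]])
        (simp add: C_ring_sel cong: restrict_cong)
  qed (auto simp: C_ring_sel C_ring_closed restrict_in_C_ring continuous_map_C_ring algebra_simps
      intro!: C_ring_eqI cong: restrict_cong)
  show "Group.comm_monoid (C_ring X)"
    by (rule comm_monoidI)
      (auto simp: C_ring_sel C_ring_closed restrict_in_C_ring continuous_map_C_ring algebra_simps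
      intro!: C_ring_eqI cong: restrict_cong)
qed (auto simp: C_ring_sel C_ring_closed restrict_in_C_ring continuous_map_C_ring algebra_simps
      intro!: C_ring_eqI cong: restrict_cong)

lemma minus_C_ring:
  assumes f: "f \<in> carrier (C_ring X)" and g: "g \<in> carrier (C_ring X)"
  shows "f \<ominus>\<^bsub>C_ring X\<^esub> g = (\<lambda>x\<in>topspace X. f x - g x)"
proof -
  interpret cring "C_ring X" by (rule cring_C_ring)
  have "(\<lambda>x\<in>topspace X. - g x) \<oplus>\<^bsub>C_ring X\<^esub> g = \<zero>\<^bsub>C_ring X\<^esub>"
    by (simp add: C_ring_sel cong: restrict_cong)
  then have "\<ominus>\<^bsub>C_ring X\<^esub> g = (\<lambda>x\<in>topspace X. - g x)"
    using minus_equality C_ring_closed(2)[OF g] g by blast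
  then show ?thesis
    by (simp add: a_minus_def C_ring_sel cong: restrict_cong)
qed

lemma minus_mem_ideal_trans:
  assumes I: "ideal I (C_ring X)"
    and c: "f \<in> carrier (C_ring X)" "g \<in> carrier (C_ring X)" "h \<in> carrier (C_ring X)"
    and m: "f \<ominus>\<^bsub>C_ring X\<^esub> g \<in> I" "g \<ominus>\<^bsub>C_ring X\<^esub> h \<in> I"
  shows "f \<ominus>\<^bsub>C_ring X\<^esub> h \<in> I"
proof -
  interpret ideal I "C_ring X" by (rule I)
  have "(f \<ominus>\<^bsub>C_ring X\<^esub> g) \<oplus>\<^bsub>C_ring X\<^esub> (g \<ominus>\<^bsub>C_ring X\<^esub> h) \<in> I"
    using m by (rule additive_subgroup.a_closed[OF is_additive_subgroup])
  also have "(f \<ominus>\<^bsub>C_ring X\<^esub> g) \<oplus>\<^bsub>C_ring X\<^esub> (g \<ominus>\<^bsub>C_ring X\<^esub> h) = f \<ominus>\<^bsub>C_ring X\<^esub> h"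
    using c by (simp add: minus_C_ring C_ring_sel cong: restrict_cong)
  finally show ?thesis .
qed

lemma minus_self_mem_ideal:
  assumes I: "ideal I (C_ring X)" and f: "f \<in> carrier (C_ring X)"
  shows "f \<ominus>\<^bsub>C_ring X\<^esub> f \<in> I"
proof -
  interpret ideal I "C_ring X" by (rule I)
  show ?thesis using f by (simp add: a_minus_def r_neg)
qed

lemma openin_uI_topology:
  assumes I: "ideal I (C_ring X)"
  shows "openin (uI_topology X I) =
    arbitrary union_of (\<lambda>B. \<exists>f \<epsilon>. B = B_u X f I \<epsilon> \<and> f \<in> carrier (C_ring X) \<and> 0 < \<epsilon>)"
proof -
  have self: "f \<in> B_u X f I \<epsilon>" if "f \<in> carrier (C_ring X)" "0 < \<epsilon>" for f \<epsilon>
  proof -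
    have "(SUP x\<in>topspace X. ereal \<bar>f x - f x\<bar>) \<le> 0"
      by (auto intro: SUP_least simp: zero_ereal_def)
    also have "0 < ereal \<epsilon>" using that by simp
    finally show ?thesis
      using that minus_self_mem_ideal[OF I] by (simp add: B_u_def)
  qed
  have mono: "B_u X f I \<epsilon> \<subseteq> B_u X f I \<delta>" if "\<epsilon> \<le> \<delta>" for f \<epsilon> \<delta>
    using that by (auto simp: B_u_def intro: less_le_trans)
  have sub: "\<exists>\<delta>>0. B_u X h I \<delta> \<subseteq> B_u X f I \<epsilon>"
    if f: "f \<in> carrier (C_ring X)" and h: "h \<in> B_u X f I \<epsilon>" and e: "0 < \<epsilon>" for f h \<epsilon>
  proof -
    let ?s = "SUP x\<in>topspace X. ereal \<bar>f x - h x\<bar>"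
    have "max 0 ?s < ereal \<epsilon>" using h e by (simp add: B_u_def)
    then obtain r where r: "max 0 ?s < ereal r" "ereal r < ereal \<epsilon>"
      using ereal_dense2 by blast
    have "B_u X h I (\<epsilon> - r) \<subseteq> B_u X f I \<epsilon>"
    proof
      fix g assume g: "g \<in> B_u X h I (\<epsilon> - r)"
      let ?t = "SUP x\<in>topspace X. ereal \<bar>h x - g x\<bar>"
      obtain q where q: "?t < ereal q" "ereal q < ereal (\<epsilon> - r)"
        using g ereal_dense2[of ?t "ereal (\<epsilon> - r)"] unfolding B_u_def by blast
      have "\<bar>f x - g x\<bar> \<le> r + q" if x: "x \<in> topspace X" for x
      proof -
        have "ereal \<bar>f x - h x\<bar> \<le> ?s" "ereal \<bar>h x - g x\<bar> \<le> ?t"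
          using x by (auto intro: SUP_upper)
        moreover have "?s < ereal r" "?t < ereal q" using r q by simp_all
        ultimately have "ereal \<bar>f x - h x\<bar> < ereal r" "ereal \<bar>h x - g x\<bar> < ereal q"
          by (meson le_less_trans)+
        then show ?thesis by simp
      qed
      then have "(SUP x\<in>topspace X. ereal \<bar>f x - g x\<bar>) \<le> ereal (r + q)"
        by (auto intro: SUP_least)
      also have "\<dots> < ereal \<epsilon>" using q by simp
      finally have "(SUP x\<in>topspace X. ereal \<bar>f x - g x\<bar>) < ereal \<epsilon>" .
      moreover have "f \<ominus>\<^bsub>C_ring X\<^esub> g \<in> I"
        using minus_mem_ideal_trans[OF I f, of h g] g h by (auto simp: B_u_def)
      ultimately show "g \<in> B_u X f I \<epsilon>" using g by (simp add: B_u_def)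
    qed
    then show ?thesis using r by (intro exI[of _ "\<epsilon> - r"]) simp
  qed
  let ?S = "{B_u X f I \<epsilon> |f \<epsilon>. f \<in> carrier (C_ring X) \<and> 0 < \<epsilon>}"
  have nb: "\<forall>f\<in>U. f \<in> carrier (C_ring X) \<and> (\<exists>\<epsilon>>0. B_u X f I \<epsilon> \<subseteq> U)"
    if "generate_topology_on ?S U" for U
    using that
  proof induction
    case (Int a b)
    show ?case
    proof
      fix f assume "f \<in> a \<inter> b"
      then obtain \<epsilon> \<delta> where d: "\<epsilon> > 0" "\<delta> > 0" "B_u X f I \<epsilon> \<subseteq> a" "B_u X f I \<delta> \<subseteq> b"
        "f \<in> carrier (C_ring X)" using Int by blast
      have "B_u X f I (min \<epsilon> \<delta>) \<subseteq> a \<inter> b"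
        using mono[of "min \<epsilon> \<delta>" \<epsilon> f] mono[of "min \<epsilon> \<delta>" \<delta> f] d by simp blast
      moreover have "0 < min \<epsilon> \<delta>" using d by simp
      ultimately show "f \<in> carrier (C_ring X) \<and> (\<exists>\<epsilon>>0. B_u X f I \<epsilon> \<subseteq> a \<inter> b)"
        using d by blast
    qed
  next
    case (UN K)
    then show ?case by (meson UnionE Union_upper order_trans)
  next
    case (Basis s)
    then obtain f \<epsilon> where s: "s = B_u X f I \<epsilon>" "f \<in> carrier (C_ring X)" "0 < \<epsilon>" by blast
    then show ?case using sub by (auto simp: B_u_def)
  qed auto
  show ?thesis
    unfolding openin_topology_base_unique
  proof (intro conjI allI impI)
    fix V assume "\<exists>f \<epsilon>. V = B_u X f I \<epsilon> \<and> f \<in> carrier (C_ring X) \<and> 0 < \<epsilon>"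
    then show "openin (uI_topology X I) V"
      unfolding uI_topology_def by (intro topology_generated_by_Basis) blast
  next
    fix U f assume "openin (uI_topology X I) U \<and> f \<in> U"
    then have "f \<in> carrier (C_ring X) \<and> (\<exists>\<epsilon>>0. B_u X f I \<epsilon> \<subseteq> U)"
      using nb[of U] by (simp add: uI_topology_def openin_topology_generated_by_iff)
    then show "\<exists>V. (\<exists>f \<epsilon>. V = B_u X f I \<epsilon> \<and> f \<in> carrier (C_ring X) \<and> 0 < \<epsilon>) \<and> f \<in> V \<and> V \<subseteq> U"
      using self by blast
  qed
qed

lemma openin_mI_topology:
  assumes I: "ideal I (C_ring X)"
  shows "openin (mI_topology X I) =
    arbitrary union_of (\<lambda>B. \<exists>f u. B = B_m X f I u \<and> f \<in> carrier (C_ring X) \<and> u \<in> C_plus X)"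
proof -
  have self: "f \<in> B_m X f I u" if "f \<in> carrier (C_ring X)" "u \<in> C_plus X" for f u
    using that minus_self_mem_ideal[OF I] by (simp add: B_m_def C_plus_def)
  have sub: "\<exists>v\<in>C_plus X. B_m X h I v \<subseteq> B_m X f I u"
    if f: "f \<in> carrier (C_ring X)" and h: "h \<in> B_m X f I u" and u: "u \<in> C_plus X" for f h u
  proof
    let ?v = "\<lambda>x\<in>topspace X. u x - \<bar>f x - h x\<bar>"
    have "continuous_map X euclideanreal (\<lambda>x. u x - \<bar>f x - h x\<bar>)"
      using f h u by (auto simp: B_m_def C_plus_def C_ring_def
          intro!: continuous_map_diff continuous_map_real_abs)
    then have "continuous_map X euclideanreal ?v"
      by (rule continuous_map_eq) simp
    then show "?v \<in> C_plus X"
      using h by (simp add: B_m_def C_plus_def C_ring_def)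
    show "B_m X h I ?v \<subseteq> B_m X f I u"
    proof
      fix g assume g: "g \<in> B_m X h I ?v"
      have "f \<ominus>\<^bsub>C_ring X\<^esub> g \<in> I"
        using minus_mem_ideal_trans[OF I f, of h g] g h by (auto simp: B_m_def)
      moreover have "\<bar>f x - g x\<bar> < u x" if "x \<in> topspace X" for x
      proof -
        have "\<bar>h x - g x\<bar> < u x - \<bar>f x - h x\<bar>" using g that by (simp add: B_m_def)
        then show ?thesis by linarith
      qed
      ultimately show "g \<in> B_m X f I u" using g by (simp add: B_m_def)
    qed
  qed
  have inter: "\<exists>w\<in>C_plus X. B_m X f I w \<subseteq> B_m X f I u \<inter> B_m X f I v"
    if u: "u \<in> C_plus X" and v: "v \<in> C_plus X" for f u v
  proof
    let ?w = "\<lambda>x\<in>topspace X. min (u x) (v x)"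
    have "continuous_map X euclideanreal (\<lambda>x. min (u x) (v x))"
      using u v by (auto simp: C_plus_def C_ring_def
          intro!: continuous_map_real_min)
    then have "continuous_map X euclideanreal ?w"
      by (rule continuous_map_eq) simp
    then show "?w \<in> C_plus X"
      using u v by (simp add: C_plus_def C_ring_def)
    show "B_m X f I ?w \<subseteq> B_m X f I u \<inter> B_m X f I v"
      by (auto simp: B_m_def)
  qed
  let ?S = "{B_m X f I u |f u. f \<in> carrier (C_ring X) \<and> u \<in> C_plus X}"
  have nb: "\<forall>f\<in>U. f \<in> carrier (C_ring X) \<and> (\<exists>u\<in>C_plus X. B_m X f I u \<subseteq> U)"
    if "generate_topology_on ?S U" for U
    using that
  proof induction
    case (Int a b)
    show ?case
    proof
      fix f assume "f \<in> a \<inter> b"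
      then obtain u v where "u \<in> C_plus X" "v \<in> C_plus X" "B_m X f I u \<subseteq> a" "B_m X f I v \<subseteq> b"
        "f \<in> carrier (C_ring X)" using Int by blast
      then show "f \<in> carrier (C_ring X) \<and> (\<exists>u\<in>C_plus X. B_m X f I u \<subseteq> a \<inter> b)"
        using inter[of u v f] by blast
    qed
  next
    case (UN K)
    then show ?case by (meson UnionE Union_upper order_trans)
  next
    case (Basis s)
    then obtain f u where s: "s = B_m X f I u" "f \<in> carrier (C_ring X)" "u \<in> C_plus X" by blast
    then show ?case using sub by (auto simp: B_m_def)
  qed auto
  show ?thesis
    unfolding openin_topology_base_unique
  proof (intro conjI allI impI)
    fix V assume "\<exists>f u. V = B_m X f I u \<and> f \<in> carrier (C_ring X) \<and> u \<in> C_plus X"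
    then show "openin (mI_topology X I) V"
      unfolding mI_topology_def by (intro topology_generated_by_Basis) blast
  next
    fix U f assume "openin (mI_topology X I) U \<and> f \<in> U"
    then have "f \<in> carrier (C_ring X) \<and> (\<exists>u\<in>C_plus X. B_m X f I u \<subseteq> U)"
      using nb[of U] by (simp add: mI_topology_def openin_topology_generated_by_iff)
    then show "\<exists>V. (\<exists>f u. V = B_m X f I u \<and> f \<in> carrier (C_ring X) \<and> u \<in> C_plus X) \<and> f \<in> V \<and> V \<subseteq> U"
      using self by blast
  qed
qed

end

(* All the countability conditions give, through the coarser topology u^I, a countable subset of C(X)
   whose u^I-balls of a fixed radius cover C(X). For every f, two distinct real multiples of f then
   lie in the same ball, which forces f to be bounded and to lie in I; hence X is pseudocompact and
   I = C(X). The countable net also separates points from closed sets, so X is second countable, thus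
   Lindelof, thus compact, and it embeds in a countable power of the reals. Conversely, over a compact
   metrizable X with I = C(X) both topologies coincide with that of the separable space C(X). *)
theory Submission
  imports Defs
begin

section \<open>Countability conditions on topological spaces\<close>

text \<open>Radii vary from point to point in m^I, so no net is extracted there. The conditions pass
  to a coarser topology on the same set, and the balls of u^I are those of an extended metric: the
  distance is infinite when the difference is unbounded or lies outside \<open>I\<close>. The
  multiples of one bad function would be uncountably many points at mutual distance infinity, which
  is what a countable net forbids; the radius does not matter there. A definite radius matters only
  for the topology of \<open>X\<close>: a function that is 0 at a point and 1 off a neighbourhood
  must still be cut correctly at level 1/2 after an error below 1/3. Necessity therefore needs a net
  of the single radius 1/3, while sufficiency builds nets of every radius. The two topologies
  coincide over compact \<open>X\<close> because a positive continuous function then has a positive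
  lower bound.\<close>

lemma separable_imp_countable_chain_condition:
  assumes "separable_space T"
  shows "countable_chain_condition T"
  unfolding countable_chain_condition_def
proof (intro allI impI)
  fix \<U> assume \<U>: "(\<forall>U\<in>\<U>. openin T U \<and> U \<noteq> {}) \<and> pairwise disjnt \<U>"
  obtain C where C: "countable C" "T closure_of C = topspace T"
    using assms by (auto simp: separable_space_def)
  have "\<forall>U\<in>\<U>. \<exists>c. c \<in> C \<inter> U"
    using C(2) \<U> by (fastforce simp: dense_intersects_open)
  then obtain c where "\<forall>U\<in>\<U>. c U \<in> C \<inter> U"
    by (rule bchoice[THEN exE])
  then have c: "\<And>U. U \<in> \<U> \<Longrightarrow> c U \<in> C \<and> c U \<in> U" by blast
  have "inj_on c \<U>"
  proof (rule inj_onI, rule ccontr)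
    fix U V assume "U \<in> \<U>" "V \<in> \<U>" "c U = c V" "U \<noteq> V"
    then have "disjnt U V" "c U \<in> U" "c U \<in> V"
      using c \<U> pairwiseD[of disjnt \<U> U V] by (blast, blast, metis)
    then show False by (simp add: disjnt_iff)
  qed
  moreover have "countable (c ` \<U>)"
    using c C(1) by (blast intro: countable_subset)
  ultimately show "countable \<U>"
    by (rule countable_image_inj_on[rotated])
qed

text \<open>This and the next two lemmas are applied with u^I as the coarser \<open>S\<close> and
  m^I as the finer \<open>T\<close>.\<close>

lemma countable_chain_condition_mono:
  assumes "\<And>U. openin S U \<Longrightarrow> openin T U" "countable_chain_condition T"
  shows "countable_chain_condition S"
  using assms unfolding countable_chain_condition_def by blast

lemma separable_space_mono:
  assumes "topspace S = topspace T" "\<And>U. openin S U \<Longrightarrow> openin T U" "separable_space T"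
  shows "separable_space S"
proof -
  obtain C where "countable C" "C \<subseteq> topspace T" "T closure_of C = topspace T"
    using assms(3) unfolding separable_space_def by blast
  then have "countable C \<and> C \<subseteq> topspace S \<and> S closure_of C = topspace S"
    unfolding dense_intersects_open using assms(1,2) by simp
  then show ?thesis unfolding separable_space_def by blast
qed

lemma Lindelof_space_mono:
  assumes "topspace S = topspace T" "\<And>U. openin S U \<Longrightarrow> openin T U" "Lindelof_space T"
  shows "Lindelof_space S"
  unfolding Lindelof_space_def assms(1)
proof (intro allI impI)
  fix \<U> assume "(\<forall>U\<in>\<U>. openin S U) \<and> \<Union>\<U> = topspace T"
  then show "\<exists>\<V>. countable \<V> \<and> \<V> \<subseteq> \<U> \<and> \<Union>\<V> = topspace T"
    using assms(2) by (intro Lindelof_spaceD[OF assms(3)]) auto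
qed

text \<open>Compactness gives a finite net at each scale 1/(n+1); the balls of that radius about its
  centres, over all n, form a countable base.\<close>

lemma compact_metrizable_imp_second_countable:
  assumes "compact_space X" "metrizable_space X"
  shows "second_countable X"
proof -
  obtain M d where M: "Metric_space M d" and X: "X = Metric_space.mtopology M d"
    using assms(2) metrizable_space_def by blast
  interpret Metric_space M d by (rule M)
  have "mtotally_bounded M"
    using assms(1) X compactin_imp_mtotally_bounded by (simp add: compact_space_def)
  then have "\<forall>n::nat. \<exists>K. finite K \<and> K \<subseteq> M \<and> M \<subseteq> (\<Union>x\<in>K. mball x (1 / Suc n))"
    unfolding mtotally_bounded_def by simp
  then obtain K where K: "\<And>n::nat. finite (K n)" "\<And>n. K n \<subseteq> M"
    "\<And>n. M \<subseteq> (\<Union>x\<in>K n. mball x (1 / Suc n))"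
    by metis
  define \<B> where "\<B> = (\<Union>n::nat. (\<lambda>x. mball x (1 / Suc n)) ` K n)"
  have "\<exists>V\<in>\<B>. x \<in> V \<and> V \<subseteq> U" if "openin X U" "x \<in> U" for U x
  proof -
    obtain r where r: "r > 0" "mball x r \<subseteq> U"
      using \<open>openin X U\<close> \<open>x \<in> U\<close> X openin_mtopology by auto
    \<comment> \<open>The scale is used twice: from \<open>x\<close> to the centre \<open>y\<close>,
      and from \<open>y\<close> to any other point of its ball.\<close>
    obtain n where "1 / real (Suc n) < r / 2"
      using reals_Archimedean[of "r/2"] r by (auto simp: inverse_eq_divide)
    then have n: "2 * (1 / real (Suc n)) \<le> r" by simp
    have "x \<in> M" using that X openin_subset by fastforce
    then obtain y where y: "y \<in> K n" "x \<in> mball y (1 / Suc n)"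
      using K(3)[of n] by blast
    have "mball y (1 / Suc n) \<subseteq> mball x r"
    proof
      fix z assume z: "z \<in> mball y (1 / Suc n)"
      have "d x z \<le> d y x + d y z"
        using y z by (metis commute in_mball triangle)
      also have "\<dots> < 1 / real (Suc n) + 1 / real (Suc n)"
        using y z by (simp add: add_strict_mono)
      finally show "z \<in> mball x r" using y z n by simp
    qed
    then show ?thesis using y r unfolding \<B>_def by blast
  qed
  moreover have "countable \<B>" using K(1) unfolding \<B>_def by (auto intro: countable_finite)
  moreover have "\<forall>V\<in>\<B>. openin X V" using X unfolding \<B>_def by auto
  ultimately show ?thesis unfolding second_countable_def by blast
qed

text \<open>Evaluation at the functions in \<open>A\<close> maps \<open>X\<close> into a countable
  power of the reals, which is metrizable. The map is injective by \<open>sep\<close> and closed,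
  being continuous from a compact into a Hausdorff space, so it is an embedding.\<close>

lemma compact_imp_metrizable_space:
  assumes "compact_space X" "countable A" "\<And>f. f \<in> A \<Longrightarrow> continuous_map X euclideanreal f"
    and sep: "\<And>x y. x \<in> topspace X \<Longrightarrow> y \<in> topspace X \<Longrightarrow> x \<noteq> y \<Longrightarrow> \<exists>f\<in>A. f x \<noteq> f y"
  shows "metrizable_space X"
proof -
  let ?Y = "product_topology (\<lambda>_. euclideanreal) A"
  let ?e = "\<lambda>x. \<lambda>f\<in>A. f x"
  have Y: "metrizable_space ?Y"
    using assms(2) by (auto simp: metrizable_space_product_topology metrizable_space_euclidean
        intro: countable_subset)
  have cont: "continuous_map X ?Y ?e"
    using assms(3) by (auto simp: continuous_map_componentwise)
  moreover have "inj_on ?e (topspace X)"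
    using sep by (metis (mono_tags, lifting) inj_onI restrict_apply')
  ultimately have "embedding_map X ?Y ?e"
    using assms(1) Y metrizable_imp_Hausdorff_space
    by (intro injective_closed_imp_embedding_map T1_Spaces.continuous_imp_closed_map)
  then show ?thesis
    using Y embedding_map_imp_homeomorphic_space homeomorphic_metrizable_space
      metrizable_space_subtopology by blast
qed

text \<open>The terms are dominated by (1/2)^n, so the partial sums converge uniformly by the
  Weierstrass test, and a uniform limit of continuous functions is continuous.\<close>

lemma continuous_map_weighted_suminf:
  fixes g :: "nat \<Rightarrow> 'a \<Rightarrow> real"
  assumes "\<And>n. continuous_map X euclideanreal (g n)"
    and "\<And>n x. x \<in> topspace X \<Longrightarrow> \<bar>g n x\<bar> \<le> 1"
  shows "continuous_map X euclideanreal (\<lambda>x. \<Sum>n. (1/2)^n * g n x)"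
proof -
  let ?p = "\<lambda>N x. \<Sum>n<N. (1/2)^n * g n x"
  let ?s = "\<lambda>x. \<Sum>n. (1/2)^n * g n x"
  have "uniform_limit (topspace X) ?p ?s sequentially"
    by (rule Weierstrass_m_test[where M="\<lambda>n. (1/2)^n"])
      (use assms(2) in \<open>auto simp: abs_mult summable_geometric intro: mult_left_le\<close>)
  then have "continuous_map X Met_TC.mtopology ?s"
    by (intro Met_TC.continuous_map_uniform_limit[where f="?p" and F=sequentially])
      (auto simp: uniform_limit_iff intro!: always_eventually continuous_map_sum
        continuous_map_real_mult assms(1))
  then show ?thesis by simp
qed

text \<open>If no finite subfamily covers, a weighted sum of bump functions of a countable subcover is
  positive but has infimum 0, so its reciprocal is unbounded.\<close>
lemma Lindelof_pseudocompact_imp_compact_space: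
  assumes cr: "completely_regular_space X" and L: "Lindelof_space X"
    and bdd: "\<And>f. continuous_map X euclideanreal f \<Longrightarrow> \<exists>B. \<forall>x\<in>topspace X. \<bar>f x\<bar> \<le> B"
  shows "compact_space X"
  unfolding compact_space_alt
proof (intro allI impI)
  fix \<U> assume \<U>: "(\<forall>U\<in>\<U>. openin X U) \<and> topspace X \<subseteq> \<Union>\<U>"
  have "\<exists>U g. U \<in> \<U> \<and> continuous_map X (top_of_set {0..1::real}) g \<and> g x = 0 \<and> g ` (topspace X - U) \<subseteq> {1}"
    if x: "x \<in> topspace X" for x
  proof -
    obtain U where U: "U \<in> \<U>" "x \<in> U" using \<U> x by blast
    then have "closedin X (topspace X - U)" "x \<in> topspace X - (topspace X - U)"
      using \<U> x by auto
    then show ?thesis using cr U unfolding completely_regular_space_def by metis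
  qed
  then obtain U g where U: "\<And>x. x \<in> topspace X \<Longrightarrow> U x \<in> \<U>"
    and g: "\<And>x. x \<in> topspace X \<Longrightarrow> continuous_map X (top_of_set {0..1::real}) (g x)"
      "\<And>x. x \<in> topspace X \<Longrightarrow> g x x = 0"
      "\<And>x. x \<in> topspace X \<Longrightarrow> g x ` (topspace X - U x) \<subseteq> {1}"
    by metis
  have gc: "continuous_map X euclideanreal (g x)" if "x \<in> topspace X" for x
    using g(1)[OF that] by (simp add: continuous_map_in_subtopology)
  have g01: "0 \<le> g x y" "g x y \<le> 1" if "x \<in> topspace X" "y \<in> topspace X" for x y
    using g(1)[OF that(1)] that(2) by (auto simp: continuous_map_in_subtopology)
  \<comment> \<open>As \<open>g x\<close> is 1 off \<open>U x\<close>, this set lies inside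
    \<open>U x\<close>. It is the cover to thin out, because the weight 1 - \<open>g x\<close> is
    positive exactly on it.\<close>
  let ?V = "\<lambda>x. {y \<in> topspace X. g x y < 1}"
  have "\<exists>\<V>. countable \<V> \<and> \<V> \<subseteq> ?V ` topspace X \<and> \<Union>\<V> = topspace X"
  proof (rule Lindelof_spaceD[OF L])
    fix W assume "W \<in> ?V ` topspace X"
    then obtain x where x: "x \<in> topspace X" "W = ?V x" by blast
    have "openin X {y \<in> topspace X. g x y \<in> {..<1}}"
      by (rule openin_continuous_map_preimage[OF gc[OF x(1)]]) (simp flip: open_openin)
    then show "openin X W" using x by simp
  qed (use g(2) in fastforce)
  then obtain C where C: "countable C" "C \<subseteq> topspace X" "(\<Union>x\<in>C. ?V x) = topspace X"
    by (metis (no_types, lifting) countable_subset_image)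
  show "\<exists>\<F>. finite \<F> \<and> \<F> \<subseteq> \<U> \<and> topspace X \<subseteq> \<Union>\<F>"
  proof (cases "C = {}")
    case True
    then show ?thesis using C(3) by (intro exI[of _ "{}"]) auto
  next
    case False
    define c where "c = from_nat_into C"
    have c: "range c = C" unfolding c_def using False C(1) by (rule range_from_nat_into)
    then have cX: "c n \<in> topspace X" for n using C(2) by blast
    define w where "w n y = 1 - g (c n) y" for n y
    have w01: "0 \<le> w n y" "w n y \<le> 1" if "y \<in> topspace X" for n y
      using g01[OF cX that] by (auto simp: w_def)
    let ?h = "\<lambda>y. \<Sum>n. (1/2)^n * w n y"
    have sm: "summable (\<lambda>n. (1/2)^n * w n y)" if "y \<in> topspace X" for y
      by (rule summable_comparison_test'[where g="\<lambda>n. (1/2)^n" and N=0])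
        (use w01[OF that] in \<open>auto simp: abs_mult summable_geometric intro: mult_left_le\<close>)
    have hc: "continuous_map X euclideanreal ?h"
      by (rule continuous_map_weighted_suminf)
        (use w01 gc cX in \<open>auto simp: w_def intro!: continuous_map_diff\<close>)
    have pos: "?h y > 0" if y: "y \<in> topspace X" for y
    proof -
      obtain n where "g (c n) y < 1" using y C(3) c by blast
      then have "0 < (1/2)^n * w n y" by (simp add: w_def)
      then show ?thesis
        by (rule suminf_pos2[OF sm[OF y], rotated]) (use w01[OF y] in simp)
    qed
    have "continuous_map X euclideanreal (\<lambda>y. inverse (?h y))"
      using hc pos by (intro continuous_map_real_inverse) force+
    then obtain B where B: "\<And>y. y \<in> topspace X \<Longrightarrow> \<bar>inverse (?h y)\<bar> \<le> B"
      using bdd by blast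
    define B' where "B' = max B 1"
    have low: "1 / B' \<le> ?h y" if y: "y \<in> topspace X" for y
    proof -
      have "inverse (?h y) \<le> B'" using B[OF y] unfolding B'_def by linarith
      then have "inverse B' \<le> ?h y"
        using pos[OF y] le_imp_inverse_le[of "inverse (?h y)" B'] by simp
      then show ?thesis by (simp add: inverse_eq_divide)
    qed
    have "0 < 1 / B'" by (simp add: B'_def)
    then have "0 < 1 / B' / 2" by simp
    \<comment> \<open>A point at which the first \<open>N\<close> weights vanish has
      \<open>?h\<close> at most the geometric tail \<open>2 * (1/2)^N\<close>. This choice puts the
      tail below the lower bound \<open>1 / B'\<close>, so the first \<open>N\<close> sets already
      cover.\<close>
    then obtain N where "(1/2)^N < 1 / B' / 2"
      using real_arch_pow_inv[of "1 / B' / 2" "1/2"] by auto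
    then have N: "2 * (1/2)^N < 1 / B'" by simp
    have "y \<in> U (c n)" if "y \<in> topspace X" "w n y \<noteq> 0" for n y
      using g(3)[OF cX, of n] that by (auto simp: w_def image_subset_iff)
    moreover have "\<exists>n<N. w n y \<noteq> 0" if y: "y \<in> topspace X" for y
    proof (rule ccontr)
      assume no: "\<not> ?thesis"
      have "?h y = (\<Sum>n. (1/2)^(n+N) * w (n+N) y) + (\<Sum>n<N. (1/2)^n * w n y)"
        by (rule suminf_split_initial_segment[OF sm[OF y]])
      also have "\<dots> = (\<Sum>n. (1/2)^(n+N) * w (n+N) y)" using no by simp
      also have "\<dots> \<le> (\<Sum>n. (1/2)^N * (1/2)^n)"
      proof (intro suminf_le summable_mult summable_geometric)
        show "summable (\<lambda>n. (1/2)^(n+N) * w (n+N) y)"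
          by (rule summable_ignore_initial_segment[OF sm[OF y]])
      qed (use w01[OF y] in \<open>auto simp: power_add mult.commute intro: mult_left_le\<close>)
      also have "\<dots> = 2 * (1/2)^N"
        by (subst suminf_mult) (auto simp: summable_geometric suminf_geometric)
      finally show False using N low[OF y] by simp
    qed
    ultimately have "topspace X \<subseteq> \<Union>((\<lambda>n. U (c n)) ` {..<N})" by blast
    then show ?thesis using U cX by (intro exI[of _ "(\<lambda>n. U (c n)) ` {..<N}"]) auto
  qed
qed

section \<open>Basic neighbourhoods in the two topologies\<close>

text \<open>Trades the extended-real supremum for a real uniform bound with strict slack, the form
  in which bounds can be added. Over an empty space both sides hold vacuously, the supremum being
  minus infinity.\<close>

lemma mem_B_u_iff:
  "g \<in> B_u X f I \<epsilon> \<longleftrightarrow> g \<in> carrier (C_ring X) \<and>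
     (\<exists>\<delta><\<epsilon>. \<forall>x\<in>topspace X. \<bar>f x - g x\<bar> \<le> \<delta>) \<and> f \<ominus>\<^bsub>C_ring X\<^esub> g \<in> I"
proof -
  let ?s = "SUP x\<in>topspace X. ereal \<bar>f x - g x\<bar>"
  have "?s < ereal \<epsilon> \<longleftrightarrow> (\<exists>\<delta><\<epsilon>. \<forall>x\<in>topspace X. \<bar>f x - g x\<bar> \<le> \<delta>)"
  proof
    assume "?s < ereal \<epsilon>"
    then obtain \<delta> where "?s < ereal \<delta>" "ereal \<delta> < ereal \<epsilon>"
      using ereal_dense2[of ?s "ereal \<epsilon>"] by blast
    moreover have "\<bar>f x - g x\<bar> \<le> \<delta>" if "x \<in> topspace X" for x
    proof -
      have "ereal \<bar>f x - g x\<bar> \<le> ?s" using that by (rule SUP_upper)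
      also note \<open>?s < ereal \<delta>\<close>
      finally show ?thesis by simp
    qed
    ultimately show "\<exists>\<delta><\<epsilon>. \<forall>x\<in>topspace X. \<bar>f x - g x\<bar> \<le> \<delta>" by auto
  next
    assume "\<exists>\<delta><\<epsilon>. \<forall>x\<in>topspace X. \<bar>f x - g x\<bar> \<le> \<delta>"
    then obtain \<delta> where "\<delta> < \<epsilon>" "\<forall>x\<in>topspace X. \<bar>f x - g x\<bar> \<le> \<delta>" by blast
    then have "?s \<le> ereal \<delta>" by (auto intro: SUP_least)
    then show "?s < ereal \<epsilon>" using \<open>\<delta> < \<epsilon>\<close> by (simp add: le_less_trans)
  qed
  then show ?thesis by (auto simp: B_u_def)
qed

lemma B_u_mono: "\<epsilon> \<le> \<delta> \<Longrightarrow> B_u X f I \<epsilon> \<subseteq> B_u X f I \<delta>"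
  unfolding mem_B_u_iff subset_iff by (meson less_le_trans)

lemma centre_in_B_u:
  assumes "ideal I (C_ring X)" "f \<in> carrier (C_ring X)" "0 < \<epsilon>"
  shows "f \<in> B_u X f I \<epsilon>"
  using assms minus_self_mem_ideal[of I X f] by (auto simp: mem_B_u_iff)

text \<open>With \<open>centre_in_B_u\<close> and \<open>B_u_sym\<close> this lets
  \<open>B_u\<close> be handled like metric balls; the membership in \<open>I\<close> composes
  because \<open>I\<close> is closed under addition.\<close>

lemma B_u_triangle:
  assumes "ideal I (C_ring X)" "f \<in> carrier (C_ring X)" "g \<in> B_u X f I \<epsilon>" "h \<in> B_u X g I \<delta>"
  shows "h \<in> B_u X f I (\<epsilon> + \<delta>)"
proof -
  obtain a b where a: "a < \<epsilon>" "\<And>x. x \<in> topspace X \<Longrightarrow> \<bar>f x - g x\<bar> \<le> a"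
    and b: "b < \<delta>" "\<And>x. x \<in> topspace X \<Longrightarrow> \<bar>g x - h x\<bar> \<le> b"
    using assms(3,4) by (auto simp: mem_B_u_iff)
  have "\<bar>f x - h x\<bar> \<le> a + b" if "x \<in> topspace X" for x
    using a(2)[OF that] b(2)[OF that] by linarith
  moreover have "a + b < \<epsilon> + \<delta>" using a b by simp
  moreover have "f \<ominus>\<^bsub>C_ring X\<^esub> h \<in> I"
    using minus_mem_ideal_trans[OF assms(1,2), of g h] assms(3,4) by (auto simp: mem_B_u_iff)
  ultimately show ?thesis using assms(4) by (auto simp: mem_B_u_iff)
qed

lemma B_u_sym:
  assumes I: "ideal I (C_ring X)" and f: "f \<in> carrier (C_ring X)" and g: "g \<in> B_u X f I \<epsilon>"
  shows "f \<in> B_u X g I \<epsilon>"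
proof -
  interpret ideal I "C_ring X" by (rule I)
  have gC: "g \<in> carrier (C_ring X)" using g by (simp add: mem_B_u_iff)
  have "\<ominus>\<^bsub>C_ring X\<^esub> (f \<ominus>\<^bsub>C_ring X\<^esub> g) \<in> I"
    using g by (simp add: mem_B_u_iff)
  also have "\<ominus>\<^bsub>C_ring X\<^esub> (f \<ominus>\<^bsub>C_ring X\<^esub> g) = g \<ominus>\<^bsub>C_ring X\<^esub> f"
    using f gC by (simp add: a_minus_def minus_add a_comm)
  finally show ?thesis
    using f g by (simp add: mem_B_u_iff abs_minus_commute)
qed

lemma openin_B_u:
  assumes "ideal I (C_ring X)" "f \<in> carrier (C_ring X)" "0 < \<epsilon>"
  shows "openin (uI_topology X I) (B_u X f I \<epsilon>)"
  using openin_uI_topology[OF assms(1)] assms(2,3) unfolding openin_topology_base_unique by blast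

lemma openin_B_m:
  assumes "ideal I (C_ring X)" "f \<in> carrier (C_ring X)" "u \<in> C_plus X"
  shows "openin (mI_topology X I) (B_m X f I u)"
  using openin_mI_topology[OF assms(1)] assms(2,3) unfolding openin_topology_base_unique by blast

text \<open>The base only supplies a ball about some other centre \<open>h\<close>; the strict slack
  in that ball leaves room to recentre at \<open>f\<close>.\<close>

lemma openin_uI_topologyD:
  assumes I: "ideal I (C_ring X)" and U: "openin (uI_topology X I) U" "f \<in> U"
  shows "f \<in> carrier (C_ring X) \<and> (\<exists>\<epsilon>>0. B_u X f I \<epsilon> \<subseteq> U)"
proof -
  obtain V where V: "\<exists>h \<delta>. V = B_u X h I \<delta> \<and> h \<in> carrier (C_ring X) \<and> 0 < \<delta>" "f \<in> V" "V \<subseteq> U"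
    using openin_uI_topology[OF I] U unfolding openin_topology_base_unique by meson
  then obtain h \<delta> where h: "h \<in> carrier (C_ring X)" "f \<in> B_u X h I \<delta>" "B_u X h I \<delta> \<subseteq> U"
    by blast
  then obtain e where e: "e < \<delta>" "\<forall>x\<in>topspace X. \<bar>h x - f x\<bar> \<le> e"
    by (auto simp: mem_B_u_iff)
  \<comment> \<open>The slack \<open>\<delta> - e\<close> is halved: one half makes this membership
    strict, the other becomes the radius about \<open>f\<close>.\<close>
  have "f \<in> B_u X h I ((\<delta> + e) / 2)"
    using h e by (auto simp: mem_B_u_iff intro!: exI[of _ e])
  then have "B_u X f I ((\<delta> - e) / 2) \<subseteq> B_u X h I ((\<delta> + e) / 2 + (\<delta> - e) / 2)"
    using B_u_triangle[OF I h(1)] by blast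
  also have "(\<delta> + e) / 2 + (\<delta> - e) / 2 = \<delta>" by (simp add: field_simps)
  finally have "B_u X f I ((\<delta> - e) / 2) \<subseteq> U" using h(3) by blast
  moreover have "0 < (\<delta> - e) / 2" using e by simp
  moreover have "f \<in> carrier (C_ring X)" using h(2) by (simp add: mem_B_u_iff)
  ultimately show ?thesis by blast
qed

lemma topspace_uI_topology:
  assumes "ideal I (C_ring X)"
  shows "topspace (uI_topology X I) = carrier (C_ring X)"
proof
  show "topspace (uI_topology X I) \<subseteq> carrier (C_ring X)"
    using openin_uI_topologyD[OF assms openin_topspace] by blast
  show "carrier (C_ring X) \<subseteq> topspace (uI_topology X I)"
    using openin_subset[OF openin_B_u[OF assms _ zero_less_one]] centre_in_B_u[OF assms _ zero_less_one]
    by blast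
qed

lemma openin_uI_imp_mI:
  assumes I: "ideal I (C_ring X)" and U: "openin (uI_topology X I) U"
  shows "openin (mI_topology X I) U"
proof (subst openin_subopen, intro ballI)
  fix f assume "f \<in> U"
  then obtain \<epsilon> where f: "f \<in> carrier (C_ring X)" and e: "0 < \<epsilon>" "B_u X f I \<epsilon> \<subseteq> U"
    using openin_uI_topologyD[OF I U] by blast
  \<comment> \<open>Halving is needed: differences that are pointwise below
    \<open>\<epsilon>\<close> may still have supremum \<open>\<epsilon>\<close>.\<close>
  let ?u = "\<lambda>x\<in>topspace X. \<epsilon> / 2"
  have u: "?u \<in> C_plus X" using e C_ring_closed(1) by (auto simp: C_plus_def)
  have "B_m X f I ?u \<subseteq> B_u X f I \<epsilon>"
  proof
    fix g assume g: "g \<in> B_m X f I ?u"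
    then have "\<forall>x\<in>topspace X. \<bar>f x - g x\<bar> \<le> \<epsilon> / 2" by (simp add: B_m_def less_imp_le)
    moreover have "\<epsilon> / 2 < \<epsilon>" using e by simp
    ultimately show "g \<in> B_u X f I \<epsilon>"
      using g unfolding mem_B_u_iff B_m_def by blast
  qed
  moreover have "f \<in> B_m X f I ?u"
    using f e minus_self_mem_ideal[OF I f] by (auto simp: B_m_def)
  ultimately show "\<exists>T. openin (mI_topology X I) T \<and> f \<in> T \<and> T \<subseteq> U"
    using openin_B_m[OF I f u] e by blast
qed

lemma topspace_mI_topology:
  assumes "ideal I (C_ring X)"
  shows "topspace (mI_topology X I) = carrier (C_ring X)"
proof
  show "topspace (mI_topology X I) \<subseteq> carrier (C_ring X)"
    by (auto simp: mI_topology_def B_m_def)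
  show "carrier (C_ring X) \<subseteq> topspace (mI_topology X I)"
    using openin_subset[OF openin_uI_imp_mI[OF assms openin_topspace]]
    by (simp add: topspace_uI_topology[OF assms])
qed

text \<open>The room left around \<open>f\<close> inside an m^I-ball is a positive continuous
  function \<open>v\<close>. On a compact space it attains its minimum, which serves as a constant
  radius.\<close>

lemma compact_imp_mI_eq_uI_topology:
  assumes X: "compact_space X" and I: "ideal I (C_ring X)"
  shows "mI_topology X I = uI_topology X I"
  unfolding topology_eq
proof (intro allI iffI)
  fix U assume U: "openin (mI_topology X I) U"
  show "openin (uI_topology X I) U"
  proof (subst openin_subopen, intro ballI)
    fix f assume "f \<in> U"
    then obtain V where V: "\<exists>h u. V = B_m X h I u \<and> h \<in> carrier (C_ring X) \<and> u \<in> C_plus X"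
      "f \<in> V" "V \<subseteq> U"
      using openin_mI_topology[OF I] U unfolding openin_topology_base_unique by meson
    then obtain h u where h: "h \<in> carrier (C_ring X)" "u \<in> C_plus X"
      "f \<in> B_m X h I u" "B_m X h I u \<subseteq> U"
      by blast
    have f: "f \<in> carrier (C_ring X)" using h by (simp add: B_m_def)
    define v where "v x = u x - \<bar>h x - f x\<bar>" for x
    have v: "continuous_map X euclideanreal v"
      unfolding v_def using h f by (intro continuous_map_diff continuous_map_real_abs)
        (auto simp: C_plus_def C_ring_def)
    have "compact (v ` topspace X)"
      using image_compactin[OF _ v] X by (simp add: compact_space_def)
    have vpos: "0 < v x" if "x \<in> topspace X" for x
      using h(3) that by (simp add: v_def B_m_def)
    obtain e where e: "0 < e" "\<And>x. x \<in> topspace X \<Longrightarrow> e \<le> v x"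
    proof (cases "topspace X = {}")
      case True
      then show ?thesis using that[of 1] by simp
    next
      case False
      then obtain x where "x \<in> topspace X" "\<And>y. y \<in> topspace X \<Longrightarrow> v x \<le> v y"
        using compact_attains_inf[OF \<open>compact (v ` topspace X)\<close>] by auto
      then show ?thesis using that[of "v x"] vpos by blast
    qed
    have "B_u X f I e \<subseteq> B_m X h I u"
    proof
      fix g assume g: "g \<in> B_u X f I e"
      then obtain d where d: "d < e" "\<And>x. x \<in> topspace X \<Longrightarrow> \<bar>f x - g x\<bar> \<le> d"
        by (auto simp: mem_B_u_iff)
      have "\<bar>h x - g x\<bar> < u x" if "x \<in> topspace X" for x
        using d(1) d(2)[OF that] e(2)[OF that] unfolding v_def by linarith
      moreover have "h \<ominus>\<^bsub>C_ring X\<^esub> g \<in> I"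
        using minus_mem_ideal_trans[OF I h(1) f, of g] g h(3) by (auto simp: mem_B_u_iff B_m_def)
      ultimately show "g \<in> B_m X h I u" using g by (simp add: B_m_def mem_B_u_iff)
    qed
    then show "\<exists>T. openin (uI_topology X I) T \<and> f \<in> T \<and> T \<subseteq> U"
      using openin_B_u[OF I f e(1)] centre_in_B_u[OF I f e(1)] h(4) by blast
  qed
qed (rule openin_uI_imp_mI[OF I])

section \<open>Countable uniform nets\<close>

text \<open>Total boundedness with countable in place of finite, at one radius. Required at every
  positive radius, it amounts to \<aleph>0-boundedness of u^I.\<close>

definition countable_uI_net :: "'a topology \<Rightarrow> ('a \<Rightarrow> real) set \<Rightarrow> real \<Rightarrow> bool" where
  "countable_uI_net X I \<epsilon> \<longleftrightarrow>
     (\<exists>A. countable A \<and> A \<subseteq> carrier (C_ring X) \<and> carrier (C_ring X) \<subseteq> (\<Union>a\<in>A. B_u X a I \<epsilon>))"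

lemma countable_uI_netI:
  assumes "countable A" "A \<subseteq> carrier (C_ring X)"
    and "\<And>f. f \<in> carrier (C_ring X) \<Longrightarrow> \<exists>a\<in>A. f \<in> B_u X a I \<epsilon>"
  shows "countable_uI_net X I \<epsilon>"
  unfolding countable_uI_net_def by (rule exI[of _ A]) (use assms in auto)

lemma separable_imp_countable_uI_net:
  assumes I: "ideal I (C_ring X)" and "separable_space (uI_topology X I)" and e: "0 < \<epsilon>"
  shows "countable_uI_net X I \<epsilon>"
proof -
  obtain C where C: "countable C" "C \<subseteq> topspace (uI_topology X I)"
    "\<forall>T. openin (uI_topology X I) T \<and> T \<noteq> {} \<longrightarrow> C \<inter> T \<noteq> {}"
    using assms(2) unfolding separable_space_def dense_intersects_open by (elim exE conjE)
  have C': "C \<subseteq> carrier (C_ring X)" using C(2) by (simp add: topspace_uI_topology[OF I])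
  have "\<exists>a\<in>C. f \<in> B_u X a I \<epsilon>" if f: "f \<in> carrier (C_ring X)" for f
  proof -
    have "C \<inter> B_u X f I \<epsilon> \<noteq> {}"
      using C(3) openin_B_u[OF I f e] centre_in_B_u[OF I f e] by blast
    then show ?thesis using B_u_sym[OF I f] by blast
  qed
  then show ?thesis by (rule countable_uI_netI[OF C(1) C'])
qed

lemma Lindelof_imp_countable_uI_net:
  assumes I: "ideal I (C_ring X)" and L: "Lindelof_space (uI_topology X I)" and e: "0 < \<epsilon>"
  shows "countable_uI_net X I \<epsilon>"
proof -
  let ?B = "\<lambda>f. B_u X f I \<epsilon>"
  have "\<exists>\<V>. countable \<V> \<and> \<V> \<subseteq> ?B ` carrier (C_ring X) \<and> \<Union>\<V> = topspace (uI_topology X I)"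
  proof (rule Lindelof_spaceD[OF L])
    show "\<Union>(?B ` carrier (C_ring X)) = topspace (uI_topology X I)"
      using centre_in_B_u[OF I _ e] by (auto simp: topspace_uI_topology[OF I] mem_B_u_iff)
  qed (use openin_B_u[OF I _ e] in blast)
  then obtain A where "countable A" "A \<subseteq> carrier (C_ring X)" "\<Union>(?B ` A) = carrier (C_ring X)"
    unfolding topspace_uI_topology[OF I] by (metis countable_subset_image)
  then show ?thesis unfolding countable_uI_net_def by blast
qed

text \<open>Zorn's lemma yields a maximal set of centres whose balls of radius
  \<open>\<epsilon> / 2\<close> are disjoint. By maximality the half-ball about any \<open>f\<close>
  meets one of these, unless \<open>f\<close> is itself a centre, so balls of radius
  \<open>\<epsilon>\<close> about the centres cover.\<close>

lemma countable_chain_condition_imp_countable_uI_net: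
  assumes I: "ideal I (C_ring X)" and ccc: "countable_chain_condition (uI_topology X I)"
    and e: "0 < \<epsilon>"
  shows "countable_uI_net X I \<epsilon>"
proof -
  let ?B = "\<lambda>f. B_u X f I (\<epsilon> / 2)"
  have e2: "0 < \<epsilon> / 2" using e by simp
  define \<A> where "\<A> = {A. A \<subseteq> carrier (C_ring X) \<and> pairwise (\<lambda>a b. disjnt (?B a) (?B b)) A}"
  have "\<Union>\<C> \<in> \<A>" if "subset.chain \<A> \<C>" for \<C>
    using that by (auto simp: \<A>_def subset_chain_def chain_subset_def intro!: pairwise_chain_Union)
  then obtain A where A: "A \<in> \<A>" and max: "\<And>A'. A' \<in> \<A> \<Longrightarrow> A \<subseteq> A' \<Longrightarrow> A' = A"
    using subset_Zorn'[of \<A>] by metis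
  have AC: "A \<subseteq> carrier (C_ring X)" and disj: "pairwise (\<lambda>a b. disjnt (?B a) (?B b)) A"
    using A by (auto simp: \<A>_def)
  have self: "f \<in> ?B f" if "f \<in> carrier (C_ring X)" for f
    using centre_in_B_u[OF I that e2] .
  \<comment> \<open>The chain condition counts balls, not centres; injectivity carries countability
    over to \<open>A\<close>.\<close>
  have inj: "inj_on ?B A"
  proof (rule inj_onI, rule ccontr)
    fix a b assume ab: "a \<in> A" "b \<in> A" "?B a = ?B b" "a \<noteq> b"
    then have "disjnt (?B a) (?B b)" using pairwiseD[OF disj] by blast
    moreover have "a \<in> ?B a" using self AC ab(1) by blast
    ultimately show False using ab(3) by (simp add: disjnt_iff)
  qed
  have "pairwise disjnt (?B ` A)"
    using disj by (auto simp: pairwise_def)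
  moreover have "\<forall>U\<in>?B ` A. openin (uI_topology X I) U \<and> U \<noteq> {}"
    using self AC openin_B_u[OF I _ e2] by blast
  ultimately have "countable (?B ` A)"
    using ccc unfolding countable_chain_condition_def by blast
  then have "countable A" using inj by (rule countable_image_inj_on)
  moreover have "\<exists>a\<in>A. f \<in> B_u X a I \<epsilon>" if f: "f \<in> carrier (C_ring X)" for f
  proof (cases "\<exists>a\<in>A. \<not> disjnt (?B a) (?B f)")
    case True
    then obtain a g where a: "a \<in> A" "g \<in> ?B a" "g \<in> ?B f" by (auto simp: disjnt_iff)
    have "f \<in> ?B g" using B_u_sym[OF I f a(3)] .
    then have "f \<in> B_u X a I (\<epsilon> / 2 + \<epsilon> / 2)"
      using B_u_triangle[OF I _ a(2)] a(1) AC by blast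
    then show ?thesis using a(1) by auto
  next
    case False
    then have "insert f A \<in> \<A>"
      using f AC disj by (auto simp: \<A>_def pairwise_insert disjnt_sym)
    then have "f \<in> A" using max by blast
    then show ?thesis using centre_in_B_u[OF I f e] by blast
  qed
  ultimately show ?thesis using AC by (intro countable_uI_netI)
qed

lemma aleph0_bounded_imp_countable_uI_net:
  assumes I: "ideal I (C_ring X)" and b: "aleph0_bounded (C_ring X) (uI_topology X I)" and e: "0 < \<epsilon>"
  shows "countable_uI_net X I \<epsilon>"
proof -
  interpret ideal I "C_ring X" by (rule I)
  let ?V = "B_u X \<zero>\<^bsub>C_ring X\<^esub> I \<epsilon>"
  have "?V \<subseteq> carrier (C_ring X)" by (auto simp: mem_B_u_iff)
  moreover have "openin (uI_topology X I) ?V \<and> \<zero>\<^bsub>C_ring X\<^esub> \<in> ?V"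
    using openin_B_u[OF I zero_closed e] centre_in_B_u[OF I zero_closed e] by simp
  ultimately obtain A where A: "countable A" "A \<subseteq> carrier (C_ring X)"
    "carrier (C_ring X) = A <+>\<^bsub>C_ring X\<^esub> ?V"
    using b unfolding aleph0_bounded_def by (metis order_refl)
  have "\<exists>a\<in>A. f \<in> B_u X a I \<epsilon>" if f: "f \<in> carrier (C_ring X)" for f
  proof -
    have "f \<in> A <+>\<^bsub>C_ring X\<^esub> ?V" by (subst A(3)[symmetric]) (rule f)
    then obtain a v where a: "a \<in> A" "v \<in> ?V" "f = a \<oplus>\<^bsub>C_ring X\<^esub> v"
      by (auto simp: set_add_def set_mult_def)
    have aC: "a \<in> carrier (C_ring X)" and vC: "v \<in> carrier (C_ring X)"
      using a A(2) by (auto simp: mem_B_u_iff)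
    \<comment> \<open>Both sides are the negative of \<open>v\<close>, so the condition on
      \<open>v\<close> at zero is literally the condition on \<open>f\<close> at
      \<open>a\<close>.\<close>
    have "a \<ominus>\<^bsub>C_ring X\<^esub> f = \<zero>\<^bsub>C_ring X\<^esub> \<ominus>\<^bsub>C_ring X\<^esub> v"
      unfolding a(3) minus_C_ring[OF aC a_closed[OF aC vC]] minus_C_ring[OF zero_closed vC]
      by (simp add: C_ring_sel cong: restrict_cong)
    moreover have "\<bar>a x - f x\<bar> = \<bar>\<zero>\<^bsub>C_ring X\<^esub> x - v x\<bar>" if "x \<in> topspace X" for x
      using that by (simp add: a(3) C_ring_sel)
    ultimately show ?thesis using a f by (intro bexI[OF _ a(1)]) (simp add: mem_B_u_iff)
  qed
  then show ?thesis by (rule countable_uI_netI[OF A(1,2)])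
qed

text \<open>Balls are translates of the ball about zero, so the centres of a net whose radius fits
  inside \<open>V\<close> serve as the countable set.\<close>

lemma countable_uI_net_imp_aleph0_bounded:
  assumes I: "ideal I (C_ring X)" and net: "\<And>\<epsilon>. 0 < \<epsilon> \<Longrightarrow> countable_uI_net X I \<epsilon>"
  shows "aleph0_bounded (C_ring X) (uI_topology X I)"
  unfolding aleph0_bounded_def
proof (intro allI impI)
  interpret ideal I "C_ring X" by (rule I)
  fix V assume V: "V \<subseteq> carrier (C_ring X) \<and>
    (\<exists>U. openin (uI_topology X I) U \<and> \<zero>\<^bsub>C_ring X\<^esub> \<in> U \<and> U \<subseteq> V)"
  then obtain U where U: "openin (uI_topology X I) U" "\<zero>\<^bsub>C_ring X\<^esub> \<in> U" "U \<subseteq> V" by blast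
  obtain \<epsilon> where e: "0 < \<epsilon>" "B_u X \<zero>\<^bsub>C_ring X\<^esub> I \<epsilon> \<subseteq> V"
    using openin_uI_topologyD[OF I U(1,2)] U(3) by blast
  obtain A where A: "countable A" "A \<subseteq> carrier (C_ring X)"
    "carrier (C_ring X) \<subseteq> (\<Union>a\<in>A. B_u X a I \<epsilon>)"
    using net[OF e(1)] unfolding countable_uI_net_def by blast
  have "f \<in> A <+>\<^bsub>C_ring X\<^esub> V" if f: "f \<in> carrier (C_ring X)" for f
  proof -
    obtain a where a: "a \<in> A" "f \<in> B_u X a I \<epsilon>" using A(3) f by blast
    have aC: "a \<in> carrier (C_ring X)" using a A(2) by blast
    define v where "v = f \<ominus>\<^bsub>C_ring X\<^esub> a"
    have v: "v = (\<lambda>x\<in>topspace X. f x - a x)" unfolding v_def by (rule minus_C_ring[OF f aC])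
    have vC: "v \<in> carrier (C_ring X)" using f aC by (simp add: v_def)
    have "\<zero>\<^bsub>C_ring X\<^esub> \<ominus>\<^bsub>C_ring X\<^esub> v = a \<ominus>\<^bsub>C_ring X\<^esub> f"
      unfolding minus_C_ring[OF zero_closed vC] minus_C_ring[OF aC f]
      by (simp add: v C_ring_sel cong: restrict_cong)
    moreover have "\<bar>\<zero>\<^bsub>C_ring X\<^esub> x - v x\<bar> = \<bar>a x - f x\<bar>" if "x \<in> topspace X" for x
      using that by (simp add: v C_ring_sel)
    ultimately have "v \<in> V" using a vC e(2) by (auto simp: mem_B_u_iff subset_iff)
    moreover have "f = a \<oplus>\<^bsub>C_ring X\<^esub> v"
      by (intro C_ring_eqI[OF f a_closed[OF aC vC]]) (simp add: v C_ring_sel)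
    ultimately show ?thesis using a(1) by (auto simp: set_add_def set_mult_def)
  qed
  moreover have "A <+>\<^bsub>C_ring X\<^esub> V \<subseteq> carrier (C_ring X)"
    using A(2) V by (intro set_add_closed) auto
  ultimately show "\<exists>A. countable A \<and> A \<subseteq> carrier (C_ring X) \<and> carrier (C_ring X) = A <+>\<^bsub>C_ring X\<^esub> V"
    using A by blast
qed

text \<open>The metric argument again, with countable nets at the scales 1/(n+1) in place of finite
  ones.\<close>

lemma countable_uI_net_imp_second_countable:
  assumes I: "ideal I (C_ring X)" and net: "\<And>\<epsilon>. 0 < \<epsilon> \<Longrightarrow> countable_uI_net X I \<epsilon>"
  shows "second_countable (uI_topology X I)"
proof -
  have "\<forall>n::nat. countable_uI_net X I (1 / Suc n)" using net by simp
  then obtain A where A: "\<And>n::nat. countable (A n)" "\<And>n. A n \<subseteq> carrier (C_ring X)"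
    "\<And>n. carrier (C_ring X) \<subseteq> (\<Union>a\<in>A n. B_u X a I (1 / Suc n))"
    unfolding countable_uI_net_def by metis
  define \<B> where "\<B> = (\<Union>n::nat. (\<lambda>a. B_u X a I (1 / Suc n)) ` A n)"
  have "\<exists>V\<in>\<B>. f \<in> V \<and> V \<subseteq> U" if U: "openin (uI_topology X I) U" "f \<in> U" for U f
  proof -
    obtain r where f: "f \<in> carrier (C_ring X)" and r: "r > 0" "B_u X f I r \<subseteq> U"
      using openin_uI_topologyD[OF I U] by blast
    obtain n where "1 / real (Suc n) < r / 2"
      using reals_Archimedean[of "r/2"] r by (auto simp: inverse_eq_divide)
    then have n: "1 / real (Suc n) + 1 / real (Suc n) \<le> r" by simp
    obtain a where a: "a \<in> A n" "f \<in> B_u X a I (1 / Suc n)"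
      using A(3) f by blast
    then have "a \<in> B_u X f I (1 / Suc n)" using B_u_sym[OF I] A(2) by blast
    then have "B_u X a I (1 / Suc n) \<subseteq> B_u X f I (1 / real (Suc n) + 1 / real (Suc n))"
      using B_u_triangle[OF I f] by blast
    also have "\<dots> \<subseteq> B_u X f I r" by (rule B_u_mono[OF n])
    finally show ?thesis using a r unfolding \<B>_def by blast
  qed
  moreover have "countable \<B>" using A(1) unfolding \<B>_def by auto
  moreover have "\<forall>V\<in>\<B>. openin (uI_topology X I) V" using A(2) openin_B_u[OF I] unfolding \<B>_def by fastforce
  ultimately show ?thesis unfolding second_countable_def by blast
qed

text \<open>A function is pinned down up to \<open>\<epsilon>\<close> by finitely many pairs of a basic open set and a
  rational value, and there are only countably many such finite sets.\<close>
lemma compact_metrizable_imp_countable_uI_net: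
  assumes X: "compact_space X" "metrizable_space X" and e: "0 < \<epsilon>"
  shows "countable_uI_net X (carrier (C_ring X)) \<epsilon>"
proof -
  interpret cring "C_ring X" by (rule cring_C_ring)
  let ?C = "carrier (C_ring X)"
  obtain \<B> where \<B>: "countable \<B>" "\<forall>V\<in>\<B>. openin X V"
    "\<forall>U x. openin X U \<and> x \<in> U \<longrightarrow> (\<exists>V\<in>\<B>. x \<in> V \<and> V \<subseteq> U)"
    using compact_metrizable_imp_second_countable[OF X] unfolding second_countable_def
    by (elim exE conjE)
  define S where "S F = {f \<in> ?C. \<forall>(U, q)\<in>F. \<forall>x\<in>U. \<bar>f x - q\<bar> < \<epsilon> / 4}" for F :: "('a set \<times> real) set"
  \<comment> \<open>Only data that some continuous function fits are kept, so that a representative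
    \<open>a F\<close> can be chosen; the covering clause makes the data control that function on
    all of \<open>X\<close>.\<close>
  define \<F> where "\<F> = {F. finite F \<and> F \<subseteq> \<B> \<times> \<rat>} \<inter> {F. topspace X \<subseteq> \<Union>(fst ` F) \<and> S F \<noteq> {}}"
  have "countable (\<B> \<times> (\<rat> :: real set))"
    using \<B>(1) countable_rat by (rule countable_SIGMA)
  then have "countable \<F>" unfolding \<F>_def by (intro countable_Int1 countable_Collect_finite_subset)
  define a where "a F = (SOME f. f \<in> S F)" for F
  have a: "a F \<in> S F" if F: "F \<in> \<F>" for F
  proof -
    obtain f where "f \<in> S F" using F unfolding \<F>_def by blast
    then show ?thesis unfolding a_def by (rule someI[of "\<lambda>f. f \<in> S F"])
  qed
  have "\<exists>F\<in>\<F>. f \<in> B_u X (a F) ?C \<epsilon>" if f: "f \<in> ?C" for f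
  proof -
    define P where "P = {(U, q). U \<in> \<B> \<and> q \<in> \<rat> \<and> (\<forall>x\<in>U. \<bar>f x - q\<bar> < \<epsilon> / 4)}"
    have "\<exists>p\<in>P. x \<in> fst p" if x: "x \<in> topspace X" for x
    proof -
      obtain q where q: "q \<in> \<rat>" "f x - \<epsilon> / 4 < q" "q < f x + \<epsilon> / 4"
        using Rats_dense_in_real[of "f x - \<epsilon> / 4" "f x + \<epsilon> / 4"] e by auto
      have "openin X {y \<in> topspace X. f y \<in> {q - \<epsilon> / 4<..<q + \<epsilon> / 4}}"
        by (rule openin_continuous_map_preimage[OF continuous_map_C_ring[OF f]])
          (simp flip: open_openin)
      moreover have "x \<in> {y \<in> topspace X. f y \<in> {q - \<epsilon> / 4<..<q + \<epsilon> / 4}}"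
        using x q by auto
      ultimately obtain V where V: "V \<in> \<B>" "x \<in> V"
        "V \<subseteq> {y \<in> topspace X. f y \<in> {q - \<epsilon> / 4<..<q + \<epsilon> / 4}}"
        using \<B>(3) by meson
      have "\<bar>f y - q\<bar> < \<epsilon> / 4" if "y \<in> V" for y
      proof -
        have "q - \<epsilon> / 4 < f y" "f y < q + \<epsilon> / 4" using V(3) that by auto
        then show ?thesis by linarith
      qed
      then show ?thesis using V q unfolding P_def by (intro bexI[of _ "(V, q)"]) auto
    qed
    then have "topspace X \<subseteq> \<Union>(fst ` P)" by blast
    moreover have "\<forall>U\<in>fst ` P. openin X U" using \<B>(2) unfolding P_def by auto
    ultimately obtain \<G> where "finite \<G>" "\<G> \<subseteq> fst ` P" "topspace X \<subseteq> \<Union>\<G>"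
      using X(1) unfolding compact_space_alt by meson
    then obtain F where F: "finite F" "F \<subseteq> P" "topspace X \<subseteq> \<Union>(fst ` F)"
      using finite_subset_image[of \<G> fst P] by metis
    have fS: "f \<in> S F" using F(2) f by (auto simp: S_def P_def)
    have FF: "F \<in> \<F>" using F fS by (auto simp: \<F>_def P_def)
    note aS = a[OF FF]
    \<comment> \<open>Both functions are within \<open>\<epsilon> / 4\<close> of the same rational.
      The total \<open>\<epsilon> / 2\<close> is strictly below \<open>\<epsilon>\<close>, as the
      supremum must be.\<close>
    have "\<bar>a F x - f x\<bar> \<le> \<epsilon> / 2" if x: "x \<in> topspace X" for x
    proof -
      obtain p where "p \<in> F" "x \<in> fst p" using F(3) x by blast
      then obtain U q where "(U, q) \<in> F" "x \<in> U" by (cases p) auto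
      then have "\<bar>a F x - q\<bar> < \<epsilon> / 4" "\<bar>f x - q\<bar> < \<epsilon> / 4"
        using aS fS by (auto simp: S_def)
      then show ?thesis by linarith
    qed
    moreover have "a F \<in> ?C" using aS by (simp add: S_def)
    ultimately have "f \<in> B_u X (a F) ?C \<epsilon>"
      using f e by (auto simp: mem_B_u_iff intro!: exI[of _ "\<epsilon> / 2"])
    then show ?thesis using FF by blast
  qed
  moreover have "a ` \<F> \<subseteq> ?C" using a by (auto simp: S_def)
  ultimately show ?thesis
    using \<open>countable \<F>\<close> by (intro countable_uI_netI[of "a ` \<F>"]) auto
qed

text \<open>Two of the uncountably many multiples of \<open>f\<close> lie in one ball of the net; their difference is
  a nonzero multiple of \<open>f\<close>.\<close>
lemma countable_uI_net_imp_bounded_mem: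
  assumes I: "ideal I (C_ring X)" and net: "countable_uI_net X I \<epsilon>" and f: "f \<in> carrier (C_ring X)"
  shows "f \<in> I \<and> (\<exists>B. \<forall>x\<in>topspace X. \<bar>f x\<bar> \<le> B)"
proof -
  interpret ideal I "C_ring X" by (rule I)
  obtain A where A: "countable A" "A \<subseteq> carrier (C_ring X)"
    "carrier (C_ring X) \<subseteq> (\<Union>a\<in>A. B_u X a I \<epsilon>)"
    using net unfolding countable_uI_net_def by blast
  define s where "s c = (\<lambda>x\<in>topspace X. c * f x)" for c :: real
  have sC: "s c \<in> carrier (C_ring X)" for c
    unfolding s_def using continuous_map_C_ring[OF f]
    by (intro restrict_in_C_ring continuous_map_real_mult) auto
  have "\<exists>a. a \<in> A \<and> s c \<in> B_u X a I \<epsilon>" for c using A(3) sC[of c] by blast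
  then obtain a where a: "\<And>c. a c \<in> A" "\<And>c. s c \<in> B_u X (a c) I \<epsilon>" by metis
  have "\<not> inj a"
  proof
    assume "inj a"
    moreover have "countable (range a)" using a(1) A(1) by (blast intro: countable_subset)
    ultimately have "countable (UNIV :: real set)" by (rule countable_image_inj_on[rotated])
    then show False using uncountable_UNIV_real by blast
  qed
  then obtain c d where cd: "a c = a d" "c \<noteq> d" unfolding inj_def by blast
  have "a c \<in> B_u X (s c) I \<epsilon>" using B_u_sym[OF I _ a(2)] a(1) A(2) by blast
  then have "s d \<in> B_u X (s c) I (\<epsilon> + \<epsilon>)" using B_u_triangle[OF I sC] a(2)[of d] cd(1) by metis
  then obtain \<delta> where \<delta>: "\<And>x. x \<in> topspace X \<Longrightarrow> \<bar>s c x - s d x\<bar> \<le> \<delta>"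
    and m: "s c \<ominus>\<^bsub>C_ring X\<^esub> s d \<in> I" by (auto simp: mem_B_u_iff)
  \<comment> \<open>Here \<open>I\<close> must absorb products: the constant 1/(c - d) belongs to
    C(X) and turns the difference back into \<open>f\<close>.\<close>
  have "(\<lambda>x\<in>topspace X. inverse (c - d)) \<otimes>\<^bsub>C_ring X\<^esub> (s c \<ominus>\<^bsub>C_ring X\<^esub> s d) \<in> I"
    using m by (intro I_l_closed C_ring_closed)
  also have "(\<lambda>x\<in>topspace X. inverse (c - d)) \<otimes>\<^bsub>C_ring X\<^esub> (s c \<ominus>\<^bsub>C_ring X\<^esub> s d) = f"
    using cd(2) f C_ring_closed(1) sC
    by (intro C_ring_eqI[OF _ f] m_closed minus_closed)
      (auto simp: minus_C_ring C_ring_sel(1) s_def simp flip: left_diff_distrib)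
  finally have "f \<in> I" .
  moreover have "\<bar>f x\<bar> \<le> \<delta> / \<bar>c - d\<bar>" if "x \<in> topspace X" for x
  proof -
    have "s c x - s d x = (c - d) * f x" using that by (simp add: s_def left_diff_distrib)
    then have "\<bar>c - d\<bar> * \<bar>f x\<bar> \<le> \<delta>" using \<delta>[OF that] by (simp add: abs_mult)
    then show ?thesis using cd(2) by (simp add: pos_le_divide_eq mult.commute)
  qed
  ultimately show ?thesis by blast
qed

lemma countable_uI_net_imp_compact_metrizable:
  assumes X: "Tychonoff_space X" and I: "ideal I (C_ring X)" and net: "countable_uI_net X I (1/3)"
  shows "compact_space X \<and> metrizable_space X \<and> I = carrier (C_ring X)"
proof -
  interpret ideal I "C_ring X" by (rule I)
  have cr: "completely_regular_space X" and H: "Hausdorff_space X"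
    using X by (auto simp: Tychonoff_space_def)
  obtain A where A: "countable A" "A \<subseteq> carrier (C_ring X)"
    "carrier (C_ring X) \<subseteq> (\<Union>a\<in>A. B_u X a I (1/3))"
    using net unfolding countable_uI_net_def by blast
  have Ac: "continuous_map X euclideanreal a" if "a \<in> A" for a
    using that A(2) continuous_map_C_ring by blast
  have sep: "\<exists>a\<in>A. a x < 1/2 \<and> (\<forall>y\<in>topspace X - U. 1/2 < a y)"
    if U: "openin X U" "x \<in> U" for U x
  proof -
    obtain f :: "'a \<Rightarrow> real" where f: "continuous_map X euclideanreal f" "f x = 0"
      "f ` (topspace X - U) \<subseteq> {1}"
      using cr U unfolding completely_regular_space_alt' by blast
    obtain a where a: "a \<in> A" "restrict f (topspace X) \<in> B_u X a I (1/3)"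
      using A(3) restrict_in_C_ring[OF f(1)] by blast
    then obtain \<delta> where d: "\<delta> < 1/3" "\<And>y. y \<in> topspace X \<Longrightarrow> \<bar>a y - f y\<bar> \<le> \<delta>"
      by (auto simp: mem_B_u_iff)
    have "x \<in> topspace X" using U openin_subset by blast
    \<comment> \<open>With error below 1/3, \<open>a\<close> stays below 1/3 at \<open>x\<close> and
      above 2/3 off \<open>U\<close>, so the level 1/2 separates them.\<close>
    then have "a x < 1/2" using d(1) d(2)[of x] f(2) by linarith
    moreover have "1/2 < a y" if "y \<in> topspace X - U" for y
    proof -
      have "f y = 1" "y \<in> topspace X" using that f(3) by auto
      then show ?thesis using d(1) d(2)[of y] by linarith
    qed
    ultimately show ?thesis using a(1) by blast
  qed
  \<comment> \<open>By \<open>sep\<close> these sublevel sets of the net functions form a countable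
    base of \<open>X\<close>.\<close>
  let ?W = "\<lambda>a. {y \<in> topspace X. a y < 1/2}"
  have "\<exists>V\<in>?W ` A. x \<in> V \<and> V \<subseteq> U" if U: "openin X U" "x \<in> U" for U x
  proof -
    obtain a where a: "a \<in> A" "a x < 1/2" "\<forall>y\<in>topspace X - U. 1/2 < a y"
      using sep[OF U] by blast
    moreover have "x \<in> topspace X" using U openin_subset by blast
    ultimately show ?thesis by (intro bexI[of _ "?W a"]) force+
  qed
  moreover have "openin X (?W a)" if "a \<in> A" for a
  proof -
    have "openin X {y \<in> topspace X. a y \<in> {..<1/2}}"
      by (rule openin_continuous_map_preimage[OF Ac[OF that]]) (simp flip: open_openin)
    then show ?thesis by simp
  qed
  moreover have "countable (?W ` A)" using A(1) by simp
  ultimately have "second_countable X" unfolding second_countable_def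
    by (intro exI[of _ "?W ` A"]) blast
  then have "Lindelof_space X" by (rule second_countable_imp_Lindelof_space)
  moreover have "\<exists>B. \<forall>x\<in>topspace X. \<bar>f x\<bar> \<le> B" if f: "continuous_map X euclideanreal f" for f
    using countable_uI_net_imp_bounded_mem[OF I net restrict_in_C_ring[OF f]] by simp
  ultimately have "compact_space X" using cr by (intro Lindelof_pseudocompact_imp_compact_space)
  moreover have "metrizable_space X"
  proof (rule compact_imp_metrizable_space[OF \<open>compact_space X\<close> A(1) Ac])
    fix x y assume xy: "x \<in> topspace X" "y \<in> topspace X" "x \<noteq> y"
    then obtain U where "openin X U" "x \<in> U" "y \<notin> U"
      using H unfolding Hausdorff_space_def disjnt_iff by meson
    then obtain a where "a \<in> A" "a x < 1/2" "1/2 < a y" using sep[of U x] xy(2) by blast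
    then show "\<exists>f\<in>A. f x \<noteq> f y" by (intro bexI[of _ a]) auto
  qed
  moreover have "I = carrier (C_ring X)"
    using countable_uI_net_imp_bounded_mem[OF I net] a_subset by blast
  ultimately show ?thesis by blast
qed

theorem theorem6p4:
  fixes X :: "'a topology" and I :: "('a \<Rightarrow> real) set"
  assumes "Tychonoff_space X" and "ideal I (C_ring X)"
  shows "let statements =
     [aleph0_bounded (C_ring X) (mI_topology X I),
      aleph0_bounded (C_ring X) (uI_topology X I),
      compact_space X \<and> metrizable_space X \<and> I = carrier (C_ring X),
      separable_space (mI_topology X I),
      countable_chain_condition (mI_topology X I),
      second_countable (mI_topology X I),
      Lindelof_space (mI_topology X I),
      separable_space (uI_topology X I),
      Lindelof_space (uI_topology X I),
      countable_chain_condition (uI_topology X I),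
      second_countable (uI_topology X I)]
   in \<forall>P\<in>set statements. \<forall>Q\<in>set statements. P \<longleftrightarrow> Q"
proof -
  note I = assms(2)
  let ?u = "uI_topology X I" and ?m = "mI_topology X I"
  let ?K = "compact_space X \<and> metrizable_space X \<and> I = carrier (C_ring X)"
  have net: ?K if "countable_uI_net X I (1/3)"
    using countable_uI_net_imp_compact_metrizable[OF assms that] .
  have top: "topspace ?u = topspace ?m"
    by (simp add: topspace_uI_topology[OF I] topspace_mI_topology[OF I])
  note fine = openin_uI_imp_mI[OF I]
  have u: "aleph0_bounded (C_ring X) ?u \<Longrightarrow> ?K" "separable_space ?u \<Longrightarrow> ?K"
    "Lindelof_space ?u \<Longrightarrow> ?K" "countable_chain_condition ?u \<Longrightarrow> ?K"
    using aleph0_bounded_imp_countable_uI_net[OF I] separable_imp_countable_uI_net[OF I]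
      Lindelof_imp_countable_uI_net[OF I] countable_chain_condition_imp_countable_uI_net[OF I] net
    by simp_all
  have m: "aleph0_bounded (C_ring X) ?m \<Longrightarrow> ?K" "separable_space ?m \<Longrightarrow> ?K"
    "Lindelof_space ?m \<Longrightarrow> ?K" "countable_chain_condition ?m \<Longrightarrow> ?K"
  proof -
    assume "aleph0_bounded (C_ring X) ?m"
    then have "aleph0_bounded (C_ring X) ?u"
      \<comment> \<open>A neighbourhood of zero in u^I is also one in m^I, so the same countable set
        works.\<close>
      using fine unfolding aleph0_bounded_def by meson
    then show ?K by (rule u)
  next
    show "separable_space ?m \<Longrightarrow> ?K" using separable_space_mono[OF top fine] u(2) by blast
    show "Lindelof_space ?m \<Longrightarrow> ?K" using Lindelof_space_mono[OF top fine] u(3) by blast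
    show "countable_chain_condition ?m \<Longrightarrow> ?K"
      using countable_chain_condition_mono[OF fine] u(4) by blast
  qed
  have K: "second_countable ?u \<and> aleph0_bounded (C_ring X) ?u \<and> ?m = ?u" if ?K
  proof -
    have "countable_uI_net X I \<epsilon>" if "0 < \<epsilon>" for \<epsilon>
      using compact_metrizable_imp_countable_uI_net that \<open>?K\<close> by metis
    then show ?thesis
      using countable_uI_net_imp_second_countable[OF I] countable_uI_net_imp_aleph0_bounded[OF I]
        compact_imp_mI_eq_uI_topology[OF _ I] \<open>?K\<close> by blast
  qed
  have second: "separable_space T \<and> Lindelof_space T \<and> countable_chain_condition T"
    if "second_countable T" for T :: "('a \<Rightarrow> real) topology"
    using that second_countable_imp_separable_space second_countable_imp_Lindelof_space
      separable_imp_countable_chain_condition by blast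
  \<comment> \<open>Second countability reaches \<open>?K\<close> through \<open>second\<close> and
    separability. Conversely \<open>K\<close> provides it for \<open>?u\<close>, and the equality of
    the topologies moves everything to \<open>?m\<close>.\<close>
  have eq: "P \<longleftrightarrow> ?K" if "P \<in> {aleph0_bounded (C_ring X) ?m, aleph0_bounded (C_ring X) ?u, ?K,
      separable_space ?m, countable_chain_condition ?m, second_countable ?m, Lindelof_space ?m,
      separable_space ?u, Lindelof_space ?u, countable_chain_condition ?u, second_countable ?u}" for P
    using that
  proof (elim insertE emptyE)
  qed (use u m K second[of ?u] second[of ?m] in metis)+
  show ?thesis
    unfolding Let_def list.set
  proof (intro ballI)
    fix P Q
    assume P: "P \<in> {aleph0_bounded (C_ring X) ?m, aleph0_bounded (C_ring X) ?u, ?K,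
      separable_space ?m, countable_chain_condition ?m, second_countable ?m, Lindelof_space ?m,
      separable_space ?u, Lindelof_space ?u, countable_chain_condition ?u, second_countable ?u}"
      and Q: "Q \<in> {aleph0_bounded (C_ring X) ?m, aleph0_bounded (C_ring X) ?u, ?K,
      separable_space ?m, countable_chain_condition ?m, second_countable ?m, Lindelof_space ?m,
      separable_space ?u, Lindelof_space ?u, countable_chain_condition ?u, second_countable ?u}"
    show "P \<longleftrightarrow> Q" using eq[OF P] eq[OF Q] by simp
  qed
qed

end
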